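(* There exists a pair of (real-valued) harmonic functions $u_1,u_2$ on the disc $U$ such that $$\lim_{|\zeta|\to1}\max\{u_1(\zeta),u_2(\zeta)\}=+\infty.$$
   Context: $U=\{\zeta\in\mathbb{C}:|\zeta|<1\}$ is the open unit disc. *)

theory Defs
  imports "HOL-Analysis.Analysis"
begin

text \<open>Identifying \<open>\<complex>\<close> with the real plane, \<open>u\<close> has partial derivatives \<open>p\<close> (in \<open>x = Re z\<close>)
  and \<open>q\<close> (in \<open>y = Im z\<close>) on \<open>S\<close>; differentiability is total and over the reals.\<close>

definition has_partials_on ::
  "(complex \<Rightarrow> real) \<Rightarrow> (complex \<Rightarrow> real) \<Rightarrow> (complex \<Rightarrow> real) \<Rightarrow> complex set \<Rightarrow> bool" where
  "has_partials_on u p q S \<longleftrightarrow>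
     (\<forall>z\<in>S. (u has_derivative (\<lambda>h. p z * Re h + q z * Im h)) (at z))"

text \<open>Harmonic means twice continuously differentiable with vanishing Laplacian. On an open set
  the partial derivatives below are uniquely determined by \<open>u\<close>.\<close>

definition harmonic_on :: "(complex \<Rightarrow> real) \<Rightarrow> complex set \<Rightarrow> bool" where
  "harmonic_on u S \<longleftrightarrow> open S \<and>
     (\<exists>ux uy uxx uxy uyx uyy.
        has_partials_on u ux uy S \<and>
        has_partials_on ux uxx uxy S \<and> has_partials_on uy uyx uyy S \<and>
        continuous_on S uxx \<and> continuous_on S uxy \<and>
        continuous_on S uyx \<and> continuous_on S uyy \<and>
        (\<forall>z\<in>S. uxx z + uyy z = 0))"

end

theory Submission
  imports Defs "HOL-Complex_Analysis.Complex_Analysis"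
    "HOL-Computational_Algebra.Fundamental_Theorem_Algebra"
begin

text \<open>
  The two functions are \<open>Re G1\<close> and \<open>Re G2\<close>, where \<open>G1\<close> and \<open>G2\<close> are locally uniform limits of
  functions \<open>f1\<close>, \<open>f2\<close> holomorphic near the closed disc and corrected infinitely often. Between two
  corrections the pair satisfies \<open>max (Re f1) (Re f2) > k\<close> on the unit circle; a correction replaces
  \<open>k\<close> by an arbitrarily large \<open>k'\<close>, is as small as desired on a given smaller disc, and loses at most
  \<open>e\<close> wherever the maximum already exceeded \<open>k\<close> (lemma \<open>raising_step\<close>). The last property is what
  survives in the limit: it protects the annulus between two consecutive circles, on which the next
  correction is not small.

  One correction works as follows. Cut the circle into \<open>N\<close> equal arcs by the sides of a regular
  \<open>N\<close>-gon. For large \<open>N\<close> each cap between an arc and its chord is so small that one of \<open>Re f1\<close>,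
  \<open>Re f2\<close> exceeds \<open>k\<close> on the whole cap; that function guards the cap, and the other one is free to
  be changed there. To the free function a large constant times an approximate indicator of the cap
  is added. The indicator is close to 1 beyond a line just inside the chord and close to 0 on the
  other side of the chord, but it is uncontrolled in the thin strip between the two lines. In that
  strip the guard keeps the maximum above \<open>k\<close>, since distinct caps are disjoint and the guard is
  nearly unchanged on this one.

  On the circle itself this leaves the short arcs near the vertices of the polygon, where the strips
  end. They are taken care of by adding to both functions beforehand one function with
  nonnegative real part that is huge near the vertices and small on the given inner disc
  (lemma \<open>peak_kernel\<close>). Nonnegativity makes this harmless everywhere else. At a point of such an
  arc at most one of the two functions is then disturbed by an indicator, and the other is huge.

  The approximate indicators come from a Runge argument (lemma \<open>half_plane_indicator\<close>): a rational
  function with the required behaviour has all its poles in the strip, and because the strip leaves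
  the disc the poles can be pushed along it out of the disc.
\<close>

section \<open>Pole pushing\<close>

text \<open>Uniform approximation on \<open>K\<close> by functions holomorphic in a neighbourhood of \<open>A\<close>. Below, \<open>A\<close> is
  the closed disc and \<open>K\<close> the disc without a strip.\<close>

definition approximable :: "complex set \<Rightarrow> complex set \<Rightarrow> (complex \<Rightarrow> complex) \<Rightarrow> bool" where
  "approximable A K f \<longleftrightarrow> (\<forall>e>0. \<exists>g. g analytic_on A \<and> (\<forall>z\<in>K. norm (f z - g z) < e))"

lemma approximable_analytic: "f analytic_on A \<Longrightarrow> approximable A K f"
  unfolding approximable_def by (metis cancel_comm_monoid_add_class.diff_cancel norm_zero)

lemma approximable_limit:
  assumes "\<And>e. e > 0 \<Longrightarrow> \<exists>g. approximable A K g \<and> (\<forall>z\<in>K. norm (f z - g z) < e)"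
  shows "approximable A K f"
  unfolding approximable_def
proof (intro allI impI)
  fix e :: real assume "e > 0"
  then obtain g where g: "approximable A K g" "\<forall>z\<in>K. norm (f z - g z) < e/2"
    using assms[of "e/2"] by auto
  then obtain h where h: "h analytic_on A" "\<forall>z\<in>K. norm (g z - h z) < e/2"
    unfolding approximable_def using \<open>e > 0\<close> half_gt_zero by blast
  have "norm (f z - h z) < e" if "z \<in> K" for z
    using g(2) h(2) that norm_triangle_lt[of "f z - g z" "g z - h z" e] by fastforce
  then show "\<exists>g. g analytic_on A \<and> (\<forall>z\<in>K. norm (f z - g z) < e)"
    using h(1) by blast
qed

lemma approximable_add:
  assumes "approximable A K f" "approximable A K g"
  shows "approximable A K (\<lambda>z. f z + g z)"
  unfolding approximable_def
proof (intro allI impI)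
  fix e :: real assume e: "e > 0"
  obtain p where p: "p analytic_on A" "\<forall>z\<in>K. norm (f z - p z) < e/2"
    using assms(1) e unfolding approximable_def by (meson half_gt_zero)
  obtain q where q: "q analytic_on A" "\<forall>z\<in>K. norm (g z - q z) < e/2"
    using assms(2) e unfolding approximable_def by (meson half_gt_zero)
  have "norm ((f z + g z) - (p z + q z)) < e" if "z \<in> K" for z
    using p(2) q(2) that norm_triangle_lt[of "f z - p z" "g z - q z" e]
    by (fastforce simp: algebra_simps)
  then show "\<exists>h. h analytic_on A \<and> (\<forall>z\<in>K. norm (f z + g z - h z) < e)"
    using analytic_on_add[OF p(1) q(1)] by blast
qed

lemma approximable_bounded:
  assumes "approximable A K f" "compact K" "K \<subseteq> A"
  obtains B where "B > 0" "\<And>z. z \<in> K \<Longrightarrow> norm (f z) \<le> B"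
proof -
  obtain p where p: "p analytic_on A" "\<forall>z\<in>K. norm (f z - p z) < 1"
    using assms(1) unfolding approximable_def by (meson zero_less_one)
  have "continuous_on K p"
    using p(1) assms(3) analytic_on_subset analytic_imp_holomorphic holomorphic_on_imp_continuous_on by blast
  then have "bounded (p ` K)" using assms(2) compact_continuous_image compact_imp_bounded by blast
  then obtain B where B: "B > 0" "\<And>z. z \<in> K \<Longrightarrow> norm (p z) \<le> B"
    by (auto simp: bounded_pos)
  have "norm (f z) \<le> B + 1" if "z \<in> K" for z
    using p(2) B(2)[OF that] that norm_triangle_sub[of "f z" "p z"] by fastforce
  with B(1) that[of "B+1"] show ?thesis by simp
qed

lemma approximable_mult:
  assumes "approximable A K f" "approximable A K g" "compact K" "K \<subseteq> A"
  shows "approximable A K (\<lambda>z. f z * g z)"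
  unfolding approximable_def
proof (intro allI impI)
  fix e :: real assume e: "e > 0"
  obtain B where B: "B > 0" "\<And>z. z \<in> K \<Longrightarrow> norm (f z) \<le> B"
    using approximable_bounded[OF assms(1,3,4)] by metis
  define d where "d = e / (2*B)"
  have "d > 0" using B e by (simp add: d_def)
  then obtain q where q: "q analytic_on A" "\<forall>z\<in>K. norm (g z - q z) < d"
    using assms(2) unfolding approximable_def by meson
  obtain C where C: "C > 0" "\<And>z. z \<in> K \<Longrightarrow> norm (q z) \<le> C"
    using approximable_bounded[OF approximable_analytic[OF q(1)] assms(3,4)] by metis
  have "e / (2*C) > 0" using C e by simp
  then obtain p where p: "p analytic_on A" "\<forall>z\<in>K. norm (f z - p z) < e / (2*C)"
    using assms(1) unfolding approximable_def by meson
  have "norm (f z * g z - p z * q z) < e" if z: "z \<in> K" for z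
  proof -
    have 1: "norm (f z) * norm (g z - q z) \<le> B * norm (g z - q z)"
      using B(2)[OF z] by (intro mult_right_mono) auto
    have 2: "B * norm (g z - q z) < B * d" using q(2) z B(1) by simp
    have 3: "norm (f z - p z) * norm (q z) \<le> norm (f z - p z) * C"
      using C(2)[OF z] by (intro mult_left_mono) auto
    have 4: "norm (f z - p z) * C < e / (2*C) * C" using p(2) z C(1) by (intro mult_strict_right_mono) auto
    have "f z * g z - p z * q z = f z * (g z - q z) + (f z - p z) * q z"
      by (simp add: algebra_simps)
    then have "norm (f z * g z - p z * q z) \<le> norm (f z) * norm (g z - q z) + norm (f z - p z) * norm (q z)"
      by (metis norm_mult norm_triangle_ineq)
    also have "\<dots> < B * d + e / (2*C) * C" using 1 2 3 4 by linarith
    also have "\<dots> = e" using B(1) C(1) by (simp add: d_def)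
    finally show ?thesis .
  qed
  then show "\<exists>h. h analytic_on A \<and> (\<forall>z\<in>K. norm (f z * g z - h z) < e)"
    using analytic_on_mult[OF p(1) q(1)] by blast
qed

lemma approximable_power:
  assumes "approximable A K f" "compact K" "K \<subseteq> A"
  shows "approximable A K (\<lambda>z. f z ^ n)"
proof (induction n)
  case 0
  then show ?case by (simp add: approximable_analytic)
next
  case (Suc n)
  then show ?case using approximable_mult[OF assms(1) Suc assms(2,3)] by simp
qed

lemma approximable_sum:
  fixes n :: nat
  assumes "\<And>i. i < n \<Longrightarrow> approximable A K (f i)"
  shows "approximable A K (\<lambda>z. \<Sum>i<n. f i z)"
  using assms
proof (induction n)
  case 0
  then show ?case by (simp add: approximable_analytic)
next
  case (Suc n)
  then show ?case using approximable_add[of A K "\<lambda>z. \<Sum>i<n. f i z" "f n"] by simp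
qed

text \<open>The geometric series for \<open>1 / (z - b)\<close> in powers of \<open>(b - a) / (z - a)\<close> converges
  uniformly on \<open>K\<close>, so a pole can be moved by half its distance from \<open>K\<close>.\<close>

lemma approximable_inverse_near:
  assumes K: "compact K" "K \<subseteq> A"
    and a: "approximable A K (\<lambda>z. inverse (z - a))"
    and d: "d > 0" "\<And>z. z \<in> K \<Longrightarrow> d \<le> norm (z - a)" "norm (b - a) \<le> d / 2"
  shows "approximable A K (\<lambda>z. inverse (z - b))"
proof (rule approximable_limit)
  fix e :: real assume e: "e > 0"
  obtain n where n: "(1/2::real) ^ n < e * d / 2"
    using real_arch_pow_inv[of "e*d/2" "1/2"] e d(1) by auto
  define g where "g z = inverse (z - a) * (\<Sum>i<n. ((b - a) * inverse (z - a)) ^ i)" for z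
  have "approximable A K (\<lambda>z. (b - a) * inverse (z - a))"
    by (intro approximable_mult approximable_analytic a K) auto
  then have "approximable A K (\<lambda>z. \<Sum>i<n. ((b - a) * inverse (z - a)) ^ i)"
    using K by (intro approximable_sum approximable_power) auto
  then have "approximable A K g"
    unfolding g_def using K a by (intro approximable_mult)
  moreover have "norm (inverse (z - b) - g z) < e" if z: "z \<in> K" for z
  proof -
    define x where "x = (b - a) * inverse (z - a)"
    have za: "norm (z - a) \<ge> d" "z \<noteq> a" using d(1) d(2)[OF z] by auto
    have "norm x = norm (b - a) / norm (z - a)"
      by (simp add: x_def norm_mult norm_inverse divide_inverse)
    also have "\<dots> \<le> (d/2) / d" using za d by (intro frac_le) auto
    finally have x: "norm x \<le> 1/2" using d(1) by simp
    have x1: "x \<noteq> 1" using x by auto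
    have *: "1 - x = (z - b) * inverse (z - a)" using za by (simp add: x_def field_simps)
    have zb: "z \<noteq> b" using * x1 by auto
    have "inverse (z - b) = inverse (z - a) * (1 / (1 - x))"
      unfolding * using za zb by (simp add: field_simps)
    moreover have "g z = inverse (z - a) * ((1 - x ^ n) / (1 - x))"
      using x1 by (simp add: g_def sum_gp_strict flip: x_def)
    ultimately have "inverse (z - b) - g z = inverse (z - a) * (x ^ n / (1 - x))"
      by (simp add: algebra_simps diff_divide_distrib)
    then have "norm (inverse (z - b) - g z) = inverse (norm (z - a)) * (norm x ^ n / norm (1 - x))"
      by (simp add: norm_mult norm_inverse norm_divide norm_power)
    also have "\<dots> \<le> inverse d * ((1/2) ^ n / (1/2))"
    proof (intro mult_mono frac_le power_mono)
      show "1/2 \<le> norm (1 - x)" using x norm_triangle_ineq2[of 1 x] by simp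
    qed (use za d(1) x in \<open>auto intro: le_imp_inverse_le\<close>)
    also have "\<dots> < e" using n d(1) by (simp add: field_simps)
    finally show ?thesis .
  qed
  ultimately show "\<exists>g. approximable A K g \<and> (\<forall>z\<in>K. norm (inverse (z - b) - g z) < e)" by blast
qed

text \<open>Short moves of the pole, chained through the connected complement of \<open>K\<close>, lead from
  any \<open>b\<close> to a point outside \<open>A\<close>, where a pole does no harm.\<close>

lemma approximable_inverse:
  assumes K: "compact K" "K \<subseteq> A" "connected (- K)"
    and a: "a \<notin> A" and b: "b \<notin> K"
  shows "approximable A K (\<lambda>z. inverse (z - b))"
proof -
  have "approximable A K (\<lambda>z. inverse (z - a))"
  proof (rule approximable_analytic)
    show "(\<lambda>z. inverse (z - a)) analytic_on A" using a by (intro analytic_intros) auto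
  qed
  then show ?thesis
  proof (rule connected_induction_simple[OF K(3), rotated 2, where P = "\<lambda>c. approximable A K (\<lambda>z. inverse (z - c))"])
    show "a \<in> - K" "b \<in> - K" using a b K(2) by auto
  next
    fix c assume c: "c \<in> - K"
    show "\<exists>T. openin (top_of_set (- K)) T \<and> c \<in> T \<and>
      (\<forall>x\<in>T. \<forall>y\<in>T. approximable A K (\<lambda>z. inverse (z - x)) \<longrightarrow> approximable A K (\<lambda>z. inverse (z - y)))"
    proof -
      have "open (- K)" using K(1) by (simp add: compact_imp_closed open_Compl)
      then obtain d where d: "d > 0" "ball c d \<subseteq> - K" using c open_contains_ball by blast
      show ?thesis
      proof (intro exI[of _ "ball c (d/8)"] conjI ballI impI)
        show "openin (top_of_set (- K)) (ball c (d/8))"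
          using d \<open>open (- K)\<close> by (intro open_openin_trans) (auto simp: subset_iff)
        show "c \<in> ball c (d/8)" using d(1) by simp
        fix x y
        assume xy: "x \<in> ball c (d/8)" "y \<in> ball c (d/8)"
          and x: "approximable A K (\<lambda>z. inverse (z - x))"
        show "approximable A K (\<lambda>z. inverse (z - y))"
        proof (rule approximable_inverse_near[OF K(1,2) x, of "d/2"])
          fix z assume "z \<in> K"
          then have "dist c z \<ge> d" using d(2) by (meson ComplD mem_ball not_le subsetD)
          then show "d/2 \<le> norm (z - x)"
            using xy(1) d(1) dist_triangle[of c z x]
            by (auto simp: dist_commute dist_norm[of z x, symmetric])
        next
          show "norm (y - x) \<le> d/2/2"
            using xy dist_triangle[of y x c]
            by (auto simp: dist_commute dist_norm[of y x, symmetric])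
        qed (use d in auto)
      qed
    qed
  qed
qed

text \<open>The reciprocal factors over the roots, and each factor is a simple pole.\<close>

lemma approximable_inverse_poly:
  assumes K: "compact K" "K \<subseteq> A" "connected (- K)" "A \<noteq> UNIV"
  shows "p \<noteq> 0 \<Longrightarrow> (\<And>z. z \<in> K \<Longrightarrow> poly p z \<noteq> 0) \<Longrightarrow> approximable A K (\<lambda>z. inverse (poly p z))"
proof (induction "degree p" arbitrary: p)
  case 0
  then obtain c where "p = [:c:]" using degree_0_id by metis
  then show ?case by (simp add: approximable_analytic)
next
  case (Suc n)
  then obtain b where b: "poly p b = 0" using alg_closed_imp_poly_has_root[of p] by auto
  then obtain q where q: "p = [:- b, 1:] * q" using poly_eq_0_iff_dvd by blast
  have q0: "q \<noteq> 0" using q Suc.prems(1) by auto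
  then have "degree p = Suc (degree q)" unfolding q by (subst degree_mult_eq) auto
  then have "n = degree q" using Suc.hyps(2) by simp
  moreover have "poly q z \<noteq> 0" if "z \<in> K" for z using Suc.prems(2)[OF that] q by auto
  ultimately have "approximable A K (\<lambda>z. inverse (poly q z))" using Suc.hyps(1) q0 by blast
  moreover have "approximable A K (\<lambda>z. inverse (z - b))"
    using approximable_inverse[OF K(1-3)] K(4) b Suc.prems(2) by blast
  ultimately have "approximable A K (\<lambda>z. inverse (z - b) * inverse (poly q z))"
    using approximable_mult K by blast
  moreover have "inverse (z - b) * inverse (poly q z) = inverse (poly p z)" for z
    by (simp add: q inverse_mult_distrib[symmetric] del: inverse_mult_distrib) (simp add: algebra_simps)
  ultimately show ?case by simp
qed

section \<open>Approximate indicators of circular caps\<close>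

lemma norm_divide_add_le:
  fixes u v :: complex
  assumes "norm u \<le> k * norm v" "k < 1" "v \<noteq> 0"
  shows "u + v \<noteq> 0" "norm (u / (u + v)) \<le> k / (1 - k)"
proof -
  have k: "0 \<le> k" using assms(1,3) by (meson mult_less_0_iff norm_ge_zero not_le order_trans zero_less_norm_iff)
  have *: "norm (u + v) \<ge> (1 - k) * norm v"
    using assms(1) norm_diff_ineq[of v u] by (simp add: algebra_simps)
  have **: "(1 - k) * norm v > 0" using assms by simp
  then show "u + v \<noteq> 0" using * by auto
  have "norm (u / (u + v)) \<le> (k * norm v) / ((1 - k) * norm v)"
    unfolding norm_divide using assms * ** k by (intro frac_le) auto
  then show "norm (u / (u + v)) \<le> k / (1 - k)" using assms(3) by simp
qed

text \<open>The map \<open>w \<mapsto> (w - 1) / (w + 1)\<close> sends the right half-plane into the unit disc, hence a bounded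
  part of a smaller half-plane into a smaller disc. The bound \<open>k\<close> comes from
  \<open>\<bar>w + 1\<bar>\<^sup>2 - \<bar>w - 1\<bar>\<^sup>2 = 4 Re w\<close>.\<close>

lemma half_plane_ratio:
  fixes w :: complex
  assumes "\<delta> > 0" "norm w \<le> M"
  defines "k \<equiv> sqrt (1 - min 1 (4 * \<delta> / (M + 1)\<^sup>2))"
  shows "0 \<le> k" "k < 1" "Re w \<ge> \<delta> \<Longrightarrow> norm (w - 1) \<le> k * norm (w + 1)"
proof -
  have M: "M \<ge> 0" using assms(2) norm_ge_zero order_trans by blast
  define t where "t = min 1 (4 * \<delta> / (M + 1)\<^sup>2)"
  have t: "0 < t" "t \<le> 1" using assms(1) M by (auto simp: t_def)
  then show "0 \<le> k" "k < 1" by (auto simp: k_def t_def[symmetric])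
  assume w: "Re w \<ge> \<delta>"
  have "norm (w + 1) \<le> M + 1" using assms(2) norm_triangle_ineq[of w 1] by simp
  then have "(norm (w + 1))\<^sup>2 \<le> (M + 1)\<^sup>2" by (intro power_mono) auto
  then have "t * (norm (w + 1))\<^sup>2 \<le> t * (M + 1)\<^sup>2" using t by (intro mult_left_mono) auto
  also have "\<dots> \<le> (4 * \<delta> / (M + 1)\<^sup>2) * (M + 1)\<^sup>2" by (intro mult_right_mono) (auto simp: t_def)
  also have "\<dots> = 4 * \<delta>" using M by simp
  also have "\<dots> \<le> 4 * Re w" using w by simp
  also have "\<dots> = (norm (w + 1))\<^sup>2 - (norm (w - 1))\<^sup>2"
    unfolding cmod_power2 by (simp add: power2_eq_square algebra_simps)
  finally have "(norm (w - 1))\<^sup>2 \<le> (1 - t) * (norm (w + 1))\<^sup>2" by (simp add: algebra_simps)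
  also have "\<dots> = (k * norm (w + 1))\<^sup>2"
    using t by (simp add: k_def t_def[symmetric] power_mult_distrib)
  finally show "norm (w - 1) \<le> k * norm (w + 1)"
    by (rule power2_le_imp_le) (use t in \<open>simp add: k_def t_def[symmetric]\<close>)
qed

text \<open>The strip joins the exterior of the disc, because it contains points with imaginary part 2.\<close>

lemma connected_slit_disc_complement:
  assumes "x0 < x1"
  shows "connected (- {z::complex. norm z \<le> 1 \<and> (Re z \<le> x0 \<or> x1 \<le> Re z)})"
proof -
  have "- {z::complex. norm z \<le> 1 \<and> (Re z \<le> x0 \<or> x1 \<le> Re z)}
      = - cball 0 1 \<union> ({z. x0 < Re z} \<inter> {z. Re z < x1})" by auto
  moreover have "connected (- cball (0::complex) 1)"
    by (rule connected_complement_bounded_convex) auto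
  moreover have "connected ({z::complex. x0 < Re z} \<inter> {z. Re z < x1})"
    by (intro convex_connected convex_Int convex_halfspace_Re_lt convex_halfspace_Re_gt)
  moreover have "Complex ((x0 + x1)/2) 2 \<in> - cball 0 1 \<inter> ({z. x0 < Re z} \<inter> {z. Re z < x1})"
    using assms abs_Im_le_cmod[of "Complex ((x0 + x1)/2) 2"] by auto
  ultimately show ?thesis by (metis connected_Un empty_iff)
qed

text \<open>With \<open>T = (z - x - 1) / (z - x + 1)\<close>, where \<open>x\<close> is the midpoint of \<open>x0\<close> and \<open>x1\<close>, the function
  \<open>1 / (1 + T ^ m)\<close> tends to 1 on the right of the line \<open>Re z = x\<close>, where \<open>\<bar>T\<bar> < 1\<close>, and to 0 on its
  left, where \<open>\<bar>T\<bar> > 1\<close>. Its poles satisfy \<open>\<bar>T\<bar> = 1\<close> and so lie on that line, inside the strip.\<close>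

lemma half_plane_indicator:
  assumes "x0 < x1" "e > 0"
  obtains q where "q analytic_on cball 0 1"
    and "\<And>z. norm z \<le> 1 \<Longrightarrow> Re z \<le> x0 \<Longrightarrow> norm (q z) < e"
    and "\<And>z. norm z \<le> 1 \<Longrightarrow> x1 \<le> Re z \<Longrightarrow> norm (q z - 1) < e"
proof -
  define K where "K = {z::complex. norm z \<le> 1 \<and> (Re z \<le> x0 \<or> x1 \<le> Re z)}"
  define x where "x = (x0 + x1) / 2"
  define \<delta> where "\<delta> = (x1 - x0) / 2"
  have \<delta>: "\<delta> > 0" using assms by (simp add: \<delta>_def)
  define M where "M = 1 + \<bar>x\<bar>"
  define k where "k = sqrt (1 - min 1 (4 * \<delta> / (M + 1)\<^sup>2))"
  have M: "norm (z - of_real x) \<le> M" "norm (of_real x - z) \<le> M" if "norm z \<le> 1" for z :: complex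
    using that norm_triangle_ineq4[of z "of_real x"] norm_minus_commute[of z "of_real x"] by (auto simp: M_def)
  have k: "0 \<le> k" "k < 1"
    using half_plane_ratio(1,2)[OF \<delta> M(1)[of 0]] by (auto simp: k_def)
  obtain m where m: "k ^ m < min (1/2) (e/4)"
    using real_arch_pow_inv[of "min (1/2) (e/4)" k] k assms(2) by auto
  have small: "k ^ m / (1 - k ^ m) < e / 2"
  proof -
    have "k ^ m / (1 - k ^ m) \<le> k ^ m / (1/2)" using m k by (intro divide_left_mono) auto
    then have "k ^ m / (1 - k ^ m) \<le> 2 * k ^ m" by simp
    moreover have "2 * k ^ m < e / 2" using m by auto
    ultimately show ?thesis by (rule order_le_less_trans)
  qed
  \<comment> \<open>Clearing denominators in \<open>1 / (1 + T ^ m)\<close> gives \<open>v / (u + v)\<close>, which is defined also at the pole of \<open>T\<close>.\<close>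
  define u where "u z = (z - of_real x - 1) ^ m" for z :: complex
  define v where "v z = (z - of_real x + 1) ^ m" for z :: complex
  have right: "norm (u z) \<le> k ^ m * norm (v z)" "v z \<noteq> 0" if "norm z \<le> 1" "x1 \<le> Re z" for z :: complex
  proof -
    have "Re (z - of_real x) \<ge> \<delta>" using that(2) by (simp add: x_def \<delta>_def field_simps)
    then have "norm (z - of_real x - 1) \<le> k * norm (z - of_real x + 1)"
      using half_plane_ratio(3)[OF \<delta> M(1)[OF that(1)]] by (simp add: k_def)
    then show "norm (u z) \<le> k ^ m * norm (v z)"
      unfolding u_def v_def norm_power power_mult_distrib[symmetric] by (intro power_mono) auto
    have "Re (z - of_real x + 1) \<noteq> 0" using \<open>Re (z - of_real x) \<ge> \<delta>\<close> \<delta> by simp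
    then show "v z \<noteq> 0" unfolding v_def by (metis power_not_zero zero_complex.sel(1))
  qed
  have left: "norm (v z) \<le> k ^ m * norm (u z)" "u z \<noteq> 0" if "norm z \<le> 1" "Re z \<le> x0" for z :: complex
  proof -
    have *: "Re (of_real x - z) \<ge> \<delta>" using that(2) by (simp add: x_def \<delta>_def field_simps)
    then have "norm (of_real x - z - 1) \<le> k * norm (of_real x - z + 1)"
      using half_plane_ratio(3)[OF \<delta> M(2)[OF that(1)]] by (simp add: k_def)
    then have "norm (z - of_real x + 1) \<le> k * norm (z - of_real x - 1)"
      using norm_minus_cancel[of "z - of_real x + 1"] norm_minus_cancel[of "z - of_real x - 1"]
      by (simp add: algebra_simps)
    then show "norm (v z) \<le> k ^ m * norm (u z)"
      unfolding u_def v_def norm_power power_mult_distrib[symmetric] by (intro power_mono) auto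
    have "Re (z - of_real x - 1) \<noteq> 0" using * \<delta> by simp
    then show "u z \<noteq> 0" unfolding u_def by (metis power_not_zero zero_complex.sel(1))
  qed
  have km: "k ^ m < 1" using m by simp
  define D :: "complex poly" where "D = [:- of_real x - 1, 1:] ^ m + [:- of_real x + 1, 1:] ^ m"
  have D: "poly D z = u z + v z" for z by (simp add: D_def u_def v_def algebra_simps)
  have "poly D (of_real x + 1) = 0 ^ m + 2 ^ m" unfolding D u_def v_def by simp
  also have "\<dots> \<noteq> (0::complex)" by (cases m) auto
  finally have D0: "D \<noteq> 0" by auto
  have DK: "poly D z \<noteq> 0" if "z \<in> K" for z
    unfolding D using that left right norm_divide_add_le(1)[OF _ km] unfolding K_def
    by (metis (no_types, lifting) add.commute mem_Collect_eq)
  have K: "compact K" "K \<subseteq> cball 0 1" "connected (- K)" "cball (0::complex) 1 \<noteq> UNIV"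
  proof -
    have "K = cball 0 1 \<inter> ({z. Re z \<le> x0} \<union> {z. x1 \<le> Re z})" by (auto simp: K_def)
    then show "compact K"
      by (simp add: closed_Un closed_halfspace_Re_le closed_halfspace_Re_ge compact_Int_closed)
    show "K \<subseteq> cball 0 1" by (auto simp: K_def)
    show "connected (- K)" unfolding K_def by (rule connected_slit_disc_complement[OF assms(1)])
    have "(2::complex) \<notin> cball 0 1" by simp
    then show "cball (0::complex) 1 \<noteq> UNIV" by blast
  qed
  have "v analytic_on cball 0 1" unfolding v_def by (intro analytic_intros)
  then have "approximable (cball 0 1) K (\<lambda>z. v z * inverse (poly D z))"
    using approximable_inverse_poly[OF K D0 DK] K(1,2) by (intro approximable_mult[OF approximable_analytic])
  then obtain q where q: "q analytic_on cball 0 1" "\<forall>z\<in>K. norm (v z * inverse (poly D z) - q z) < e/2"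
    unfolding approximable_def using assms(2) by (meson half_gt_zero)
  show ?thesis
  proof
    show "q analytic_on cball 0 1" by fact
  next
    fix z :: complex assume z: "norm z \<le> 1" "Re z \<le> x0"
    have "norm (v z * inverse (poly D z)) < e/2"
      using order_le_less_trans[OF norm_divide_add_le(2)[OF left(1)[OF z] km left(2)[OF z]] small]
      unfolding D divide_inverse add.commute[of "v z"] .
    moreover have "norm (v z * inverse (poly D z) - q z) < e/2" using q(2) z by (auto simp: K_def)
    ultimately show "norm (q z) < e"
      using norm_triangle_sub[of "q z" "v z * inverse (poly D z)"] by (simp add: norm_minus_commute)
  next
    fix z :: complex assume z: "norm z \<le> 1" "x1 \<le> Re z"
    have "norm (u z / (u z + v z)) < e/2"
      by (rule order_le_less_trans[OF norm_divide_add_le(2)[OF right(1)[OF z] km right(2)[OF z]] small])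
    moreover have "v z * inverse (poly D z) - 1 = - (u z / (u z + v z))"
      using DK[of z] z by (simp add: K_def D field_simps)
    ultimately have "norm (v z * inverse (poly D z) - 1) < e/2" by (simp add: norm_minus_cancel)
    moreover have "norm (v z * inverse (poly D z) - q z) < e/2" using q(2) z by (auto simp: K_def)
    ultimately show "norm (q z - 1) < e"
      using norm_triangle_ineq[of "q z - v z * inverse (poly D z)" "v z * inverse (poly D z) - 1"]
      by (simp add: norm_minus_commute)
  qed
qed

text \<open>The caps of the disc cut off by chords in arbitrary direction are rotations of the ones cut off
  by vertical lines.\<close>

lemma cap_indicator:
  assumes "x0 < x1" "e > 0" "norm c = 1"
  obtains q where "q analytic_on cball 0 1"
    and "\<And>z. norm z \<le> 1 \<Longrightarrow> Re (z * cnj c) \<le> x0 \<Longrightarrow> norm (q z) < e"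
    and "\<And>z. norm z \<le> 1 \<Longrightarrow> x1 \<le> Re (z * cnj c) \<Longrightarrow> norm (q z - 1) < e"
proof -
  obtain q where q: "q analytic_on cball 0 1"
    "\<And>z. norm z \<le> 1 \<Longrightarrow> Re z \<le> x0 \<Longrightarrow> norm (q z) < e"
    "\<And>z. norm z \<le> 1 \<Longrightarrow> x1 \<le> Re z \<Longrightarrow> norm (q z - 1) < e"
    using half_plane_indicator[OF assms(1,2)] by metis
  have n: "norm (z * cnj c) = norm z" for z using assms(3) by (simp add: norm_mult)
  show ?thesis
  proof
    have "(q \<circ> (\<lambda>z. z * cnj c)) analytic_on cball 0 1"
    proof (rule analytic_on_compose)
      show "(\<lambda>z. z * cnj c) analytic_on cball 0 1" by (intro analytic_intros)
      show "q analytic_on (\<lambda>z. z * cnj c) ` cball 0 1"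
        using n by (intro analytic_on_subset[OF q(1)]) auto
    qed
    then show "(\<lambda>z. q (z * cnj c)) analytic_on cball 0 1" by (simp add: o_def)
  qed (use q(2,3) n in auto)
qed

section \<open>Caps over the sides of a regular polygon\<close>

lemma norm_one_plus_cis: "norm (1 + cis t) = 2 * \<bar>cos (t/2)\<bar>"
proof (rule power2_eq_imp_eq)
  have "(norm (1 + cis t))\<^sup>2 = (1 + cos t)\<^sup>2 + (sin t)\<^sup>2" by (simp add: cmod_power2)
  also have "\<dots> = 1 + 2 * cos t + ((sin t)\<^sup>2 + (cos t)\<^sup>2)" by (simp add: power2_eq_square algebra_simps)
  also have "\<dots> = 2 + 2 * cos t" by simp
  also have "\<dots> = 4 * (cos (t/2))\<^sup>2" using cos_double_cos[of "t/2"] by simp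
  also have "\<dots> = (2 * \<bar>cos (t/2)\<bar>)\<^sup>2"
    by (simp only: power_mult_distrib power2_abs) simp
  finally show "(norm (1 + cis t))\<^sup>2 = (2 * \<bar>cos (t/2)\<bar>)\<^sup>2" .
qed auto

lemma norm_root_of_unity:
  fixes c :: complex
  assumes "c ^ N = 1" "N > 0"
  shows "norm c = 1"
proof -
  have "norm c ^ N = 1" using assms by (metis norm_one norm_power)
  then show ?thesis using assms(2) power_eq_imp_eq_base[of "norm c" N 1] by simp
qed

text \<open>Distinct roots differ by an angle of at least \<open>2 * pi / N\<close>; this is what keeps the caps
  disjoint.\<close>

lemma norm_sum_roots_of_unity:
  fixes c c' :: complex
  assumes N: "N > 0" and c: "c ^ N = 1" and c': "c' ^ N = 1" and "c \<noteq> c'"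
  shows "norm (c + c') \<le> 2 * cos (pi / N)"
proof -
  have n: "norm c = 1" "norm c' = 1" using assms norm_root_of_unity by auto
  then have c0: "c \<noteq> 0" by auto
  have "(c' / c) ^ N = 1" using c c' by (simp add: power_divide)
  then obtain j where j: "j < N" "c' / c = cis (2 * pi * j / N)"
    using Complex.bij_betw_roots_unity[OF N] by (auto simp: bij_betw_def)
  have j0: "j \<noteq> 0" using j c0 assms(4) by (auto simp: field_simps intro!: Nat.gr0I)
  have "c + c' = c * (1 + c' / c)" using c0 by (simp add: field_simps)
  then have "c + c' = c * (1 + cis (2 * pi * j / N))" unfolding j(2) .
  then have "norm (c + c') = 2 * \<bar>cos (pi * j / N)\<bar>"
    by (simp add: norm_mult n norm_one_plus_cis)
  also have "\<bar>cos (pi * j / N)\<bar> \<le> cos (pi / N)"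
  proof -
    have r: "1 \<le> real j" "real j + 1 \<le> real N" using j j0 by auto
    have "pi / N \<le> pi * j / N" using r by (intro divide_right_mono) auto
    moreover have "pi * j / N \<le> pi - pi / N"
    proof -
      have "pi * (real j + 1) / N \<le> pi * N / N" using r by (intro divide_right_mono mult_left_mono) auto
      then show ?thesis using N by (simp add: field_simps)
    qed
    moreover have "0 \<le> pi / N" "0 \<le> pi * j / N" "pi - pi / N \<le> pi" by auto
    ultimately have "cos (pi * j / N) \<le> cos (pi / N)" "cos (pi - pi / N) \<le> cos (pi * j / N)"
      using cos_monotone_0_pi_le[of "pi / N" "pi * j / N"]
        cos_monotone_0_pi_le[of "pi * j / N" "pi - pi / N"] by linarith+
    then show ?thesis by simp
  qed
  finally show ?thesis by simp
qed

text \<open>A point in two caps would have inner product greater than \<open>2 * cos (pi / N)\<close> with the sum of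
  their centres, which is too short a vector.\<close>

lemma caps_disjoint:
  fixes c c' z :: complex
  assumes "N > 0" "c ^ N = 1" "c' ^ N = 1" "norm z \<le> 1"
    and "cos (pi / N) < Re (z * cnj c)" "cos (pi / N) < Re (z * cnj c')"
  shows "c = c'"
proof (rule ccontr)
  assume "c \<noteq> c'"
  have "2 * cos (pi / N) < Re (z * cnj (c + c'))" using assms(5,6) by (simp add: algebra_simps)
  also have "\<dots> \<le> norm (z * cnj (c + c'))" by (rule complex_Re_le_cmod)
  also have "\<dots> \<le> 1 * norm (c + c')" unfolding norm_mult complex_mod_cnj using assms(4) by (intro mult_right_mono) auto
  also have "\<dots> \<le> 2 * cos (pi / N)" using norm_sum_roots_of_unity[OF assms(1-3) \<open>c \<noteq> c'\<close>] by simp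
  finally show False by simp
qed

lemma cap_diameter:
  fixes c z :: complex
  assumes "norm c = 1" "norm z \<le> 1" "cos t < Re (z * cnj c)" "t \<ge> 0"
  shows "dist c z \<le> t"
proof -
  have "(norm (z - c))\<^sup>2 = (norm z)\<^sup>2 + (norm c)\<^sup>2 - 2 * Re (z * cnj c)"
    unfolding cmod_power2 by (simp add: power2_eq_square algebra_simps)
  also have "\<dots> \<le> 1 + 1 - 2 * cos t" using assms by (intro diff_mono add_mono) (auto simp: power_le_one)
  also have "\<dots> = 4 * (sin (t/2))\<^sup>2" using cos_double_sin[of "t/2"] by simp
  also have "\<dots> \<le> 4 * (t/2)\<^sup>2"
    using abs_sin_x_le_abs_x[of "t/2"] by (intro mult_left_mono) (auto simp: abs_le_square_iff[symmetric])
  also have "\<dots> = t\<^sup>2" by (simp add: power_divide)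
  finally have "norm (z - c) \<le> t" using assms(4) by (rule power2_le_imp_le)
  then show ?thesis by (simp add: dist_norm norm_minus_commute)
qed

lemma nearest_root_of_unity:
  fixes z :: complex
  assumes "norm z = 1" "N > 0"
  obtains c \<phi> where "c ^ N = 1" "\<bar>\<phi>\<bar> \<le> pi / N" "z = c * cis \<phi>"
proof -
  obtain \<theta> where \<theta>: "z = cis \<theta>" using assms(1) by (metis complex_norm_eq_1_exp cis_conv_exp)
  define j where "j = round (N * \<theta> / (2 * pi))"
  have j: "\<bar>of_int j - N * \<theta> / (2 * pi)\<bar> \<le> 1/2" unfolding j_def by (rule of_int_round_abs_le)
  define \<phi> where "\<phi> = \<theta> - 2 * pi * j / N"
  show ?thesis
  proof
    have "cis (2 * pi * j / N) ^ N = cis (2 * pi * j)" using assms(2) by (simp add: Complex.DeMoivre)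
    also have "\<dots> = 1" by (simp add: cis_conv_exp exp_eq_1 algebra_simps)
    finally show "cis (2 * pi * j / N) ^ N = 1" .
    show "z = cis (2 * pi * j / N) * cis \<phi>" by (simp add: \<theta> \<phi>_def cis_mult)
    have "\<phi> = (2 * pi / N) * (N * \<theta> / (2 * pi) - j)" using assms(2) by (simp add: \<phi>_def field_simps)
    then have "\<bar>\<phi>\<bar> = (2 * pi / N) * \<bar>of_int j - N * \<theta> / (2 * pi)\<bar>" by (simp add: abs_mult abs_minus_commute)
    also have "\<dots> \<le> (2 * pi / N) * (1/2)" using j by (intro mult_left_mono) auto
    finally show "\<bar>\<phi>\<bar> \<le> pi / N" by simp
  qed
qed

section \<open>A positive harmonic function peaking at the vertices\<close>

lemma Re_cayley: "Re ((1 + w) / (1 - w)) = (1 - (norm w)\<^sup>2) / (norm (1 - w))\<^sup>2"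
proof -
  have "Re ((1 + w) / (1 - w)) = Re ((1 + w) * cnj (1 - w)) / (norm (1 - w))\<^sup>2"
    by (simp only: Re_complex_div_gt_0 complex_div_cnj[of "1 + w"] Re_divide_of_real flip: of_real_power)
  also have "Re ((1 + w) * cnj (1 - w)) = 1 - (norm w)\<^sup>2"
    unfolding cmod_power2 by (simp add: power2_eq_square algebra_simps)
  finally show ?thesis .
qed

text \<open>A small multiple of the Cayley transform \<open>(1 + w) / (1 - w)\<close> has nonnegative real part for
  \<open>\<bar>w\<bar> \<le> 1\<close> and a pole at \<open>w = 1\<close>. With \<open>w = - z ^ N / (1 + s)\<close> the poles sit just outside the disc
  next to the vertices, the solutions of \<open>z ^ N = - 1\<close>. A point of the circle whose inner
  product with every arc centre \<open>c\<close> is less than \<open>y\<close> is so close to a vertex that the real part is at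
  least \<open>H\<close> there.\<close>

lemma peak_kernel:
  assumes N: "N > 0" and e: "e > 0" and r: "0 \<le> r" "r < 1"
  obtains h y where "h analytic_on cball 0 1" "cos (pi / N) < y"
    and "\<And>z. norm z \<le> 1 \<Longrightarrow> Re (h z) \<ge> 0"
    and "\<And>z. norm z \<le> r \<Longrightarrow> norm (h z) \<le> e"
    and "\<And>z. norm z = 1 \<Longrightarrow> (\<And>c. c ^ N = 1 \<Longrightarrow> Re (z * cnj c) < y) \<Longrightarrow> Re (h z) \<ge> H"
proof -
  define \<eta> where "\<eta> = e * (1 - r) / 2"
  have \<eta>: "\<eta> > 0" using e r by (simp add: \<eta>_def)
  define s where "s = min 1 (\<eta> / (2 * (\<bar>H\<bar> + 1)))"
  have s: "0 < s" "s \<le> 1" "s \<le> \<eta> / (2 * (\<bar>H\<bar> + 1))" using \<eta> by (auto simp: s_def)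
  have spi: "s < pi" using s pi_gt3 by linarith
  define w where "w z = - (z ^ N) / (1 + of_real s)" for z :: complex
  have s1: "norm (1 + of_real s :: complex) = 1 + s" using s(1)
    by (metis abs_of_pos add_pos_pos norm_of_real of_real_1 of_real_add zero_less_one)
  have s10: "1 + of_real s \<noteq> (0::complex)" using s1 s(1) by auto
  have nw: "norm (w z) = norm z ^ N / (1 + s)" for z
    by (simp add: w_def norm_divide norm_power s1)
  have w1: "norm (w z) < 1" "w z \<noteq> 1" if "norm z \<le> 1" for z
  proof -
    have "norm z ^ N \<le> 1" using that by (simp add: power_le_one)
    then show "norm (w z) < 1" unfolding nw using s(1) by (simp add: field_simps)
    then show "w z \<noteq> 1" by auto
  qed
  define h where "h z = of_real \<eta> * ((1 + w z) / (1 - w z))" for z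
  have Re_h: "Re (h z) = \<eta> * ((1 - (norm (w z))\<^sup>2) / (norm (1 - w z))\<^sup>2)" for z
    unfolding h_def Re_cayley[symmetric] by (simp only: times_complex.sel Re_complex_of_real Im_complex_of_real)
  show ?thesis
  proof
    have "w analytic_on cball 0 1" unfolding w_def using s10 by (intro analytic_intros) auto
    then show "h analytic_on cball 0 1"
      unfolding h_def using w1(2) by (intro analytic_intros) auto
    show "cos (pi / N) < cos ((pi - s) / N)"
      using s(1) spi N by (intro cos_monotone_0_pi) (auto simp: divide_le_eq intro!: divide_strict_right_mono)
  next
    fix z :: complex assume "norm z \<le> 1"
    then show "Re (h z) \<ge> 0"
      using Re_h w1(1) \<eta> by (simp add: power_le_one order_less_imp_le)
  next
    fix z :: complex assume z: "norm z \<le> r"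
    have "norm z ^ N \<le> norm z ^ 1" using N z r by (intro power_decreasing) auto
    then have "norm z ^ N \<le> r" using z by simp
    moreover have "norm z ^ N / (1 + s) \<le> norm z ^ N / 1" using s(1) by (intro divide_left_mono) auto
    ultimately have wr: "norm (w z) \<le> r" unfolding nw by simp
    have "norm (h z) = \<eta> * (norm (1 + w z) / norm (1 - w z))"
      using \<eta> by (simp add: h_def norm_mult norm_divide)
    also have "\<dots> \<le> \<eta> * (2 / (1 - r))"
    proof (intro mult_left_mono frac_le)
      show "norm (1 + w z) \<le> 2" using norm_triangle_ineq[of 1 "w z"] wr r by simp
      show "1 - r \<le> norm (1 - w z)" using norm_triangle_ineq2[of 1 "w z"] wr by simp
    qed (use r \<eta> in auto)
    also have "\<dots> = e" using r by (simp add: \<eta>_def)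
    finally show "norm (h z) \<le> e" .
  next
    fix z :: complex
    assume z: "norm z = 1" and far: "\<And>c. c ^ N = 1 \<Longrightarrow> Re (z * cnj c) < cos ((pi - s) / N)"
    obtain c \<phi> where c: "c ^ N = 1" "\<bar>\<phi>\<bar> \<le> pi / N" "z = c * cis \<phi>"
      using nearest_root_of_unity[OF z N] by metis
    have "c * cnj c = 1" using norm_root_of_unity[OF c(1) N] by (simp add: complex_norm_square[symmetric])
    then have "z * cnj c = cis \<phi>" unfolding c(3) by (metis mult.assoc mult.commute mult_1)
    then have "cos \<bar>\<phi>\<bar> < cos ((pi - s) / N)" using far[OF c(1)] by simp
    then have "(pi - s) / N < \<bar>\<phi>\<bar>"
    proof (rule contrapos_pp)
      assume "\<not> (pi - s) / N < \<bar>\<phi>\<bar>"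
      moreover have "(pi - s) / N \<le> pi / 1" using s(1) N by (intro frac_le) auto
      ultimately show "\<not> cos \<bar>\<phi>\<bar> < cos ((pi - s) / N)"
        using cos_monotone_0_pi_le[of "\<bar>\<phi>\<bar>" "(pi - s) / N"] by simp
    qed
    then have a: "pi - s < N * \<bar>\<phi>\<bar>" "N * \<bar>\<phi>\<bar> \<le> pi" using c(2) N by (auto simp: field_simps)
    have "z ^ N = cis (N * \<phi>)" by (simp add: c(3) power_mult_distrib c(1) Complex.DeMoivre)
    then have "norm (1 + z ^ N) = 2 * \<bar>cos (N * \<phi> / 2)\<bar>" by (simp add: norm_one_plus_cis)
    also have "\<bar>cos (N * \<phi> / 2)\<bar> = \<bar>cos (N * \<bar>\<phi>\<bar> / 2)\<bar>" by (cases "\<phi> \<ge> 0") auto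
    also have "\<dots> = \<bar>sin (pi / 2 - N * \<bar>\<phi>\<bar> / 2)\<bar>" by (simp add: cos_sin_eq)
    also have "\<dots> \<le> \<bar>pi / 2 - N * \<bar>\<phi>\<bar> / 2\<bar>" by (rule abs_sin_x_le_abs_x)
    also have "\<dots> \<le> s / 2" using a by auto
    finally have zN: "norm (1 + z ^ N) \<le> s" by simp
    have "1 - w z = (of_real s + (1 + z ^ N)) / (1 + of_real s)" using s10 by (simp add: w_def field_simps)
    then have "norm (1 - w z) = norm (of_real s + (1 + z ^ N)) / (1 + s)" by (simp add: norm_divide s1)
    also have "\<dots> \<le> (2 * s) / (1 + s)"
      using norm_triangle_ineq[of "of_real s" "1 + z ^ N"] zN s(1) by (intro divide_right_mono) auto
    finally have d: "norm (1 - w z) \<le> (2 * s) / (1 + s)" .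
    have d0: "norm (1 - w z) > 0" using w1(2)[of z] z by simp
    have "1 / (2 * s) \<le> (2 * s + s\<^sup>2) / (4 * s\<^sup>2)" using s(1) by (simp add: field_simps power2_eq_square)
    also have "\<dots> = (1 - (1 / (1 + s))\<^sup>2) / ((2 * s) / (1 + s))\<^sup>2"
    proof -
      have s2: "(1 + s)\<^sup>2 \<noteq> 0" using s(1) by simp
      have "1 - (1 / (1 + s))\<^sup>2 = (2 * s + s\<^sup>2) / (1 + s)\<^sup>2"
        using s2 by (simp add: power_divide diff_divide_eq_iff) (simp add: power2_eq_square algebra_simps)
      moreover have "((2 * s) / (1 + s))\<^sup>2 = (4 * s\<^sup>2) / (1 + s)\<^sup>2" by (simp add: power_divide power_mult_distrib)
      ultimately show ?thesis using s2 by simp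
    qed
    also have "\<dots> \<le> (1 - (norm (w z))\<^sup>2) / (norm (1 - w z))\<^sup>2"
    proof (rule frac_le)
      show "0 \<le> 1 - (norm (w z))\<^sup>2" using w1(1)[of z] z by (simp add: power_le_one)
      show "1 - (1 / (1 + s))\<^sup>2 \<le> 1 - (norm (w z))\<^sup>2" by (simp add: nw z)
      show "0 < (norm (1 - w z))\<^sup>2" using d0 by simp
      show "(norm (1 - w z))\<^sup>2 \<le> ((2 * s) / (1 + s))\<^sup>2" using d d0 by (intro power_mono) auto
    qed
    finally have "\<eta> * (1 / (2 * s)) \<le> Re (h z)"
      unfolding Re_h using \<eta> by (intro mult_left_mono) auto
    moreover have "H \<le> \<eta> * (1 / (2 * s))"
    proof -
      have "s * (2 * (\<bar>H\<bar> + 1)) \<le> \<eta>" using s(3) by (simp add: field_simps)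
      then have "\<bar>H\<bar> + 1 \<le> \<eta> * (1 / (2 * s))" using s(1) by (simp add: field_simps)
      then show ?thesis by linarith
    qed
    ultimately show "H \<le> Re (h z)" by simp
  qed
qed

section \<open>Raising the maximum on the circle\<close>

text \<open>On the compact circle the maximum exceeds \<open>k\<close> by a fixed margin, which uniform continuity
  converts into a common radius \<open>d\<close>.\<close>

lemma small_caps_labelled:
  fixes f1 f2 :: "complex \<Rightarrow> complex"
  assumes f: "f1 analytic_on cball 0 1" "f2 analytic_on cball 0 1"
    and k: "\<And>z. norm z = 1 \<Longrightarrow> k < max (Re (f1 z)) (Re (f2 z))"
  obtains d where "d > 0"
    and "\<And>c. norm c = 1 \<Longrightarrow> (\<forall>z. norm z \<le> 1 \<and> dist c z < d \<longrightarrow> k < Re (f1 z)) \<or>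
                             (\<forall>z. norm z \<le> 1 \<and> dist c z < d \<longrightarrow> k < Re (f2 z))"
proof -
  have cont: "continuous_on (cball 0 1) f1" "continuous_on (cball 0 1) f2"
    using f analytic_imp_holomorphic holomorphic_on_imp_continuous_on by blast+
  have "\<exists>z\<in>sphere 0 1. \<forall>w\<in>sphere 0 1. max (Re (f1 z)) (Re (f2 z)) \<le> max (Re (f1 w)) (Re (f2 w))"
    by (rule continuous_attains_inf)
       (auto intro!: continuous_intros continuous_on_subset[OF cont(1)] continuous_on_subset[OF cont(2)])
  then obtain z0 where z0: "norm z0 = 1"
    "\<And>w. norm w = 1 \<Longrightarrow> max (Re (f1 z0)) (Re (f2 z0)) \<le> max (Re (f1 w)) (Re (f2 w))"
    by auto
  define m where "m = max (Re (f1 z0)) (Re (f2 z0))"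
  have m: "m - k > 0" using k[OF z0(1)] by (simp add: m_def)
  have uc: "\<exists>d>0. \<forall>c z. norm c \<le> 1 \<longrightarrow> norm z \<le> 1 \<longrightarrow> dist c z < d \<longrightarrow> dist (f c) (f z) < m - k"
    if "continuous_on (cball 0 1) f" for f :: "complex \<Rightarrow> complex"
  proof -
    have "uniformly_continuous_on (cball 0 1) f" using compact_uniformly_continuous[OF that compact_cball] .
    then obtain d where d: "d > 0"
      "\<And>c z. c \<in> cball 0 1 \<Longrightarrow> z \<in> cball 0 1 \<Longrightarrow> dist z c < d \<Longrightarrow> dist (f z) (f c) < m - k"
      using m by (rule uniformly_continuous_onE) (rule that)
    have "dist (f c) (f z) < m - k" if "norm c \<le> 1" "norm z \<le> 1" "dist c z < d" for c z
      using d(2)[of z c] that by simp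
    with d(1) show ?thesis by blast
  qed
  obtain d1 d2 where d: "d1 > 0" "d2 > 0"
    "\<And>c z. norm c \<le> 1 \<Longrightarrow> norm z \<le> 1 \<Longrightarrow> dist c z < d1 \<Longrightarrow> dist (f1 c) (f1 z) < m - k"
    "\<And>c z. norm c \<le> 1 \<Longrightarrow> norm z \<le> 1 \<Longrightarrow> dist c z < d2 \<Longrightarrow> dist (f2 c) (f2 z) < m - k"
    using uc[OF cont(1)] uc[OF cont(2)] by blast
  have Re_close: "k < Re b" if "m \<le> Re a" "dist a b < m - k" for a b :: complex
    using that abs_Re_le_cmod[of "a - b"] by (auto simp: dist_norm)
  show ?thesis
  proof
    show "min d1 d2 > 0" using d by simp
    fix c :: complex assume c: "norm c = 1"
    have "m \<le> max (Re (f1 c)) (Re (f2 c))" using z0(2)[OF c] by (simp add: m_def)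
    then consider "m \<le> Re (f1 c)" | "m \<le> Re (f2 c)" by (auto simp: max_def split: if_splits)
    then show "(\<forall>z. norm z \<le> 1 \<and> dist c z < min d1 d2 \<longrightarrow> k < Re (f1 z)) \<or>
               (\<forall>z. norm z \<le> 1 \<and> dist c z < min d1 d2 \<longrightarrow> k < Re (f2 z))"
    proof cases
      case 1
      then show ?thesis using Re_close d(3)[of c] c by auto
    next
      case 2
      then show ?thesis using Re_close d(4)[of c] c by auto
    qed
  qed
qed

lemma analytic_bounded_cball:
  assumes "f analytic_on cball 0 1"
  obtains B where "B > 0" "\<And>z. norm z \<le> 1 \<Longrightarrow> \<bar>Re (f z)\<bar> \<le> B"
proof -
  have "bounded (f ` cball 0 1)"
    using assms analytic_imp_holomorphic holomorphic_on_imp_continuous_on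
    by (intro compact_imp_bounded compact_continuous_image) auto
  then obtain B where "B > 0" "\<And>z. norm z \<le> 1 \<Longrightarrow> norm (f z) \<le> B" by (auto simp: bounded_pos)
  then show ?thesis using that[of B] abs_Re_le_cmod order_trans by blast
qed

text \<open>One correction, as described at the beginning. The set \<open>I\<close> collects the centres of the caps
  guarded by \<open>f1\<close> and \<open>J\<close> those of the remaining caps, guarded by \<open>f2\<close>; hence the indicators over
  \<open>I\<close> go into \<open>g2\<close> and those over \<open>J\<close> into \<open>g1\<close>.\<close>

lemma raising_step:
  fixes f1 f2 :: "complex \<Rightarrow> complex" and k k' r e :: real
  assumes f: "f1 analytic_on cball 0 1" "f2 analytic_on cball 0 1"
    and k: "\<And>z. norm z = 1 \<Longrightarrow> k < max (Re (f1 z)) (Re (f2 z))"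
    and r: "0 \<le> r" "r < 1" and e: "e > 0"
  obtains g1 g2 where "g1 analytic_on cball 0 1" "g2 analytic_on cball 0 1"
    and "\<And>z. norm z \<le> r \<Longrightarrow> norm (g1 z) \<le> e" "\<And>z. norm z \<le> r \<Longrightarrow> norm (g2 z) \<le> e"
    and "\<And>z. norm z = 1 \<Longrightarrow> k' < max (Re (f1 z + g1 z)) (Re (f2 z + g2 z))"
    and "\<And>z. norm z \<le> 1 \<Longrightarrow> k < max (Re (f1 z)) (Re (f2 z)) \<Longrightarrow>
               k - e < max (Re (f1 z + g1 z)) (Re (f2 z + g2 z))"
proof -
  obtain d where d: "d > 0"
    "\<And>c. norm c = 1 \<Longrightarrow> (\<forall>z. norm z \<le> 1 \<and> dist c z < d \<longrightarrow> k < Re (f1 z)) \<or>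
                        (\<forall>z. norm z \<le> 1 \<and> dist c z < d \<longrightarrow> k < Re (f2 z))"
    using small_caps_labelled[OF f k] by metis
  obtain N :: nat where N: "N > 0" "pi / N < min d (1 - r)"
  proof -
    have "min d (1 - r) > 0" using d r by simp
    then obtain N :: nat where "pi / min d (1 - r) < N" using reals_Archimedean2 by blast
    moreover have "0 < pi / min d (1 - r)" using d r by simp
    ultimately have "0 < real N" "pi / min d (1 - r) < N" by linarith+
    moreover from this have "pi / N < min d (1 - r)"
      using \<open>min d (1 - r) > 0\<close> by (simp add: pos_divide_less_eq mult.commute del: min_less_iff_conj)
    ultimately show ?thesis using that by simp
  qed
  define x0 where "x0 = cos (pi / N)"
  define C where "C = {c::complex. c ^ N = 1}"
  have finC: "finite C" unfolding C_def using N(1) by (intro finite_roots_unity) auto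
  have "1 \<in> C" by (simp add: C_def)
  then have cardC: "card C > 0" using finC card_gt_0_iff by blast
  have normC: "norm c = 1" if "c \<in> C" for c using that norm_root_of_unity N(1) by (auto simp: C_def)
  have near: "dist c z < min d (1 - r)" if "c \<in> C" "norm z \<le> 1" "x0 < Re (z * cnj c)" for c z
    using cap_diameter[OF normC[OF that(1)] that(2), of "pi / N"] that(3) N(2) by (simp add: x0_def)
  have disj: "c = c'" if "c \<in> C" "c' \<in> C" "norm z \<le> 1" "x0 < Re (z * cnj c)" "x0 < Re (z * cnj c')" for c c' z
    using caps_disjoint[OF N(1)] that by (auto simp: C_def x0_def)
  define I where "I = {c \<in> C. \<forall>z. norm z \<le> 1 \<and> dist c z < d \<longrightarrow> k < Re (f1 z)}"
  define J where "J = C - I"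
  have IJ: "I \<subseteq> C" "J \<subseteq> C" "I \<inter> J = {}" "C = I \<union> J" by (auto simp: I_def J_def)
  have I: "k < Re (f1 z)" if "c \<in> I" "norm z \<le> 1" "x0 < Re (z * cnj c)" for c z
    using that near[of c z] by (auto simp: I_def)
  have J: "k < Re (f2 z)" if "c \<in> J" "norm z \<le> 1" "x0 < Re (z * cnj c)" for c z
    using that near[of c z] d(2)[OF normC[of c]] by (auto simp: I_def J_def)
  obtain B1 where B1: "B1 > 0" "\<And>z. norm z \<le> 1 \<Longrightarrow> \<bar>Re (f1 z)\<bar> \<le> B1"
    using analytic_bounded_cball[OF f(1)] by metis
  obtain B2 where B2: "B2 > 0" "\<And>z. norm z \<le> 1 \<Longrightarrow> \<bar>Re (f2 z)\<bar> \<le> B2"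
    using analytic_bounded_cball[OF f(2)] by metis
  \<comment> \<open>The constant \<open>L\<close> is at once the height of the indicators and of the peaks: it outweighs
    the most negative values of \<open>f1\<close> and \<open>f2\<close> on the disc.\<close>
  define L where "L = B1 + B2 + \<bar>k'\<bar> + 1"
  have L: "L > 0" using B1 B2 by (simp add: L_def)
  have e2: "e / 2 > 0" using e by simp
  obtain h y where h: "h analytic_on cball 0 1" "x0 < y"
    "\<And>z. norm z \<le> 1 \<Longrightarrow> Re (h z) \<ge> 0" "\<And>z. norm z \<le> r \<Longrightarrow> norm (h z) \<le> e / 2"
    "\<And>z. norm z = 1 \<Longrightarrow> (\<And>c. c ^ N = 1 \<Longrightarrow> Re (z * cnj c) < y) \<Longrightarrow> Re (h z) \<ge> L"
    unfolding x0_def using peak_kernel[OF N(1) e2 r, where H = L] by metis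
  \<comment> \<open>All indicator errors of all caps together, multiplied by \<open>L\<close>, stay below \<open>min 1 e / 2\<close>.\<close>
  define e1 where "e1 = min 1 e / (2 * L * card C)"
  have e1: "e1 > 0" "L * (card C * e1) = min 1 e / 2"
    using e L cardC by (auto simp: e1_def min_def)
  have "\<exists>q. q analytic_on cball 0 1 \<and>
      (\<forall>z. norm z \<le> 1 \<longrightarrow> Re (z * cnj c) \<le> x0 \<longrightarrow> norm (q z) < e1) \<and>
      (\<forall>z. norm z \<le> 1 \<longrightarrow> y \<le> Re (z * cnj c) \<longrightarrow> norm (q z - 1) < e1)" if "c \<in> C" for c
    using cap_indicator[OF h(2) e1(1) normC[OF that]] by metis
  then obtain q where q: "\<And>c. c \<in> C \<Longrightarrow> q c analytic_on cball 0 1"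
    "\<And>c z. c \<in> C \<Longrightarrow> norm z \<le> 1 \<Longrightarrow> Re (z * cnj c) \<le> x0 \<Longrightarrow> norm (q c z) < e1"
    "\<And>c z. c \<in> C \<Longrightarrow> norm z \<le> 1 \<Longrightarrow> y \<le> Re (z * cnj c) \<Longrightarrow> norm (q c z - 1) < e1"
    by metis
  define S where "S D z = of_real L * (\<Sum>c\<in>D. q c z)" for D z
  have S_analytic: "S D analytic_on cball 0 1" if "D \<subseteq> C" for D
    unfolding S_def using q(1) that by (intro analytic_intros) auto
  have card_e1: "L * (card D * e1) \<le> min 1 e / 2" if "D \<subseteq> C" for D
    unfolding e1(2)[symmetric] using that L e1(1) finC
    by (intro mult_left_mono mult_right_mono) (auto intro: card_mono)
  have S_small: "norm (S D z) \<le> min 1 e / 2"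
    if D: "D \<subseteq> C" and z: "norm z \<le> 1" and away: "\<And>c. c \<in> D \<Longrightarrow> Re (z * cnj c) \<le> x0" for D z
  proof -
    have "norm (\<Sum>c\<in>D. q c z) \<le> of_nat (card D) * e1"
      using q(2) D z away by (intro sum_norm_bound less_imp_le) auto
    then have "norm (S D z) \<le> L * (card D * e1)" using L by (simp add: S_def norm_mult)
    then show ?thesis using card_e1[OF D] by linarith
  qed
  have S_large: "L - 1/2 \<le> Re (S D z)"
    if D: "D \<subseteq> C" and z: "norm z \<le> 1" and c: "c \<in> D" "y \<le> Re (z * cnj c)" for D z c
  proof -
    have fin: "finite D" using D finC finite_subset by blast
    have "x0 < Re (z * cnj c)" using c(2) h(2) by simp
    then have away: "Re (z * cnj c') \<le> x0" if "c' \<in> D - {c}" for c'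
      using disj[of c c' z] that D z c(1) by force
    have "norm (\<Sum>c'\<in>D. q c' z - (if c' = c then 1 else 0)) \<le> of_nat (card D) * e1"
      using q(2,3) D z away c by (intro sum_norm_bound less_imp_le) (auto simp: subset_iff)
    then have "norm ((\<Sum>c'\<in>D. q c' z) - 1) \<le> card D * e1"
      using fin c(1) by (simp add: sum_subtractf)
    moreover have "S D z - of_real L = of_real L * ((\<Sum>c'\<in>D. q c' z) - 1)"
      by (simp add: S_def algebra_simps)
    ultimately have "norm (S D z - of_real L) \<le> L * (card D * e1)"
      using L by (simp add: norm_mult)
    also have "\<dots> \<le> 1/2" using card_e1[OF D] by simp
    finally have "\<bar>Re (S D z - of_real L)\<bar> \<le> 1/2" using abs_Re_le_cmod order_trans by blast
    then have "\<bar>Re (S D z) - L\<bar> \<le> 1/2" by simp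
    then show ?thesis unfolding abs_le_iff by linarith
  qed
  have S_lower: "- (e/2) \<le> Re (S D z)" "- (1/2) \<le> Re (S D z)"
    if D: "D \<subseteq> C" and z: "norm z \<le> 1" and away: "\<And>c. c \<in> D \<Longrightarrow> Re (z * cnj c) \<le> x0" for D z
    using S_small[OF that] abs_Re_le_cmod[of "S D z"] by auto
  define g1 where "g1 z = h z + S J z" for z
  define g2 where "g2 z = h z + S I z" for z
  have other: "Re (z * cnj c') \<le> x0"
    if "c \<in> I \<and> c' \<in> J \<or> c \<in> J \<and> c' \<in> I" "norm z \<le> 1" "x0 < Re (z * cnj c)" for c c' z
    using disj[of c c' z] that IJ by force
  show ?thesis
  proof
    show "g1 analytic_on cball 0 1" "g2 analytic_on cball 0 1"
      unfolding g1_def g2_def using h(1) S_analytic IJ by (auto intro!: analytic_intros)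
  next
    fix z :: complex assume z: "norm z \<le> r"
    have z1: "norm z \<le> 1" using z r by simp
    have far: "Re (z * cnj c) \<le> x0" if "c \<in> C" for c
    proof (rule ccontr)
      assume "\<not> Re (z * cnj c) \<le> x0"
      then have "dist c z < 1 - r" using near[OF that z1] by simp
      moreover have "norm c \<le> dist c z + norm z" using norm_triangle_sub[of c z] by (simp add: dist_norm)
      ultimately show False using z normC[OF that] by simp
    qed
    show "norm (g1 z) \<le> e" "norm (g2 z) \<le> e"
      using norm_triangle_ineq[of "h z" "S J z"] norm_triangle_ineq[of "h z" "S I z"]
        h(4)[OF z] S_small[of J z] S_small[of I z] far z1 IJ
      by (auto simp: g1_def g2_def subset_iff intro: order_trans)
  next
    fix z :: complex assume z: "norm z = 1"
    then have z1: "norm z \<le> 1" by simp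
    have h0: "Re (h z) \<ge> 0" using h(3)[OF z1] .
    have b: "\<bar>Re (f1 z)\<bar> \<le> B1" "\<bar>Re (f2 z)\<bar> \<le> B2" using B1(2) B2(2) z1 by auto
    show "k' < max (Re (f1 z + g1 z)) (Re (f2 z + g2 z))"
    proof (cases "\<exists>c\<in>C. y \<le> Re (z * cnj c)")
      case True
      then obtain c where c: "c \<in> C" "y \<le> Re (z * cnj c)" by blast
      then consider "c \<in> I" | "c \<in> J" using IJ by blast
      then show ?thesis
      proof cases
        case 1
        have "L - 1/2 \<le> Re (S I z)" using S_large[OF IJ(1) z1 1 c(2)] .
        then have "k' < Re (f2 z + g2 z)" using h0 b B1(1) by (simp add: g2_def L_def)
        then show ?thesis by simp
      next
        case 2
        have "L - 1/2 \<le> Re (S J z)" using S_large[OF IJ(2) z1 2 c(2)] .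
        then have "k' < Re (f1 z + g1 z)" using h0 b B2(1) by (simp add: g1_def L_def)
        then show ?thesis by simp
      qed
    next
      \<comment> \<open>\<open>z\<close> is near a vertex; only the function that does not guard the cap of \<open>z\<close> may be disturbed.\<close>
      case False
      then have hL: "Re (h z) \<ge> L" using h(5)[OF z] by (auto simp: C_def not_le)
      show ?thesis
      proof (cases "\<exists>c\<in>I. x0 < Re (z * cnj c)")
        case True
        then have "- (1/2) \<le> Re (S J z)" using other z1 IJ by (intro S_lower(2)) auto
        then have "k' < Re (f1 z + g1 z)" using hL b B2(1) by (simp add: g1_def L_def)
        then show ?thesis by simp
      next
        case False
        then have "- (1/2) \<le> Re (S I z)" using z1 IJ by (intro S_lower(2)) auto
        then have "k' < Re (f2 z + g2 z)" using hL b B1(1) by (simp add: g2_def L_def)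
        then show ?thesis by simp
      qed
    qed
  next
    fix z :: complex assume z: "norm z \<le> 1" and kz: "k < max (Re (f1 z)) (Re (f2 z))"
    have h0: "Re (h z) \<ge> 0" using h(3)[OF z] .
    have keep1: "k - e < Re (f1 z + g1 z)" if "k < Re (f1 z)" "\<And>c. c \<in> J \<Longrightarrow> Re (z * cnj c) \<le> x0"
      using S_lower(1)[OF IJ(2) z that(2)] h0 that(1) e by (simp add: g1_def)
    have keep2: "k - e < Re (f2 z + g2 z)" if "k < Re (f2 z)" "\<And>c. c \<in> I \<Longrightarrow> Re (z * cnj c) \<le> x0"
      using S_lower(1)[OF IJ(1) z that(2)] h0 that(1) e by (simp add: g2_def)
    \<comment> \<open>In the cap of \<open>z\<close>, if there is one, its guard still exceeds \<open>k - e\<close>; elsewhere neither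
      function has dropped by more than \<open>e\<close>.\<close>
    consider c where "c \<in> I" "x0 < Re (z * cnj c)" | c where "c \<in> J" "x0 < Re (z * cnj c)"
      | "\<And>c. c \<in> C \<Longrightarrow> Re (z * cnj c) \<le> x0" using IJ(4) not_le by blast
    then show "k - e < max (Re (f1 z + g1 z)) (Re (f2 z + g2 z))"
    proof cases
      case 1
      then have "k - e < Re (f1 z + g1 z)" using keep1 I[OF 1(1) z 1(2)] other[OF _ z 1(2)] by blast
      then show ?thesis by simp
    next
      case 2
      then have "k - e < Re (f2 z + g2 z)" using keep2 J[OF 2(1) z 2(2)] other[OF _ z 2(2)] by blast
      then show ?thesis by simp
    next
      case 3
      from kz consider "k < Re (f1 z)" | "k < Re (f2 z)" by (auto simp: max_def split: if_splits)
      then show ?thesis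
      proof cases
        case 1
        then have "k - e < Re (f1 z + g1 z)" using keep1 3 IJ by blast
        then show ?thesis by simp
      next
        case 2
        then have "k - e < Re (f2 z + g2 z)" using keep2 3 IJ by blast
        then show ?thesis by simp
      qed
    qed
  qed
qed

section \<open>Passage to the limit\<close>

lemma large_on_annulus:
  fixes f1 f2 :: "complex \<Rightarrow> complex"
  assumes f: "f1 analytic_on cball 0 1" "f2 analytic_on cball 0 1"
    and k: "\<And>z. norm z = 1 \<Longrightarrow> k < max (Re (f1 z)) (Re (f2 z))" and r: "r < 1"
  obtains r' where "r \<le> r'" "r' < 1"
    and "\<And>z. r' \<le> norm z \<Longrightarrow> norm z \<le> 1 \<Longrightarrow> k < max (Re (f1 z)) (Re (f2 z))"
proof -
  define S where "S = cball 0 1 \<inter> (\<lambda>z. max (Re (f1 z)) (Re (f2 z))) -` {..k}"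
  have "continuous_on (cball 0 1) f1" "continuous_on (cball 0 1) f2"
    using f analytic_imp_holomorphic holomorphic_on_imp_continuous_on by blast+
  then have "closed (cball 0 1 \<inter> (\<lambda>z. max (Re (f1 z)) (Re (f2 z))) -` {..k})"
    by (intro continuous_closed_preimage continuous_intros) auto
  moreover have "bounded S" unfolding S_def by (rule bounded_subset[OF bounded_cball]) auto
  ultimately have S: "compact S" unfolding S_def by (simp add: compact_eq_bounded_closed)
  show ?thesis
  proof (cases "S = {}")
    case True
    have "k < max (Re (f1 z)) (Re (f2 z))" if "norm z \<le> 1" for z
    proof (rule ccontr)
      assume "\<not> k < max (Re (f1 z)) (Re (f2 z))"
      then have "z \<in> S" using that by (simp add: S_def not_less)
      with True show False by simp
    qed
    then show ?thesis using that[of r] r by blast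
  next
    case False
    have "continuous_on S norm" by (intro continuous_intros)
    then obtain z0 where z0: "z0 \<in> S" "\<And>z. z \<in> S \<Longrightarrow> norm z \<le> norm z0"
      using continuous_attains_sup[OF S False] by blast
    have "norm z0 \<noteq> 1" using k[of z0] z0(1) by (auto simp: S_def)
    then have z1: "norm z0 < 1" using z0(1) by (auto simp: S_def)
    show ?thesis
    proof
      show "r \<le> max r ((1 + norm z0) / 2)" "max r ((1 + norm z0) / 2) < 1" using r z1 by auto
      fix z :: complex assume "max r ((1 + norm z0) / 2) \<le> norm z" "norm z \<le> 1"
      then have "z \<notin> S" "norm z \<le> 1" using z0(2)[of z] z1 by auto
      then show "k < max (Re (f1 z)) (Re (f2 z))" by (auto simp: S_def not_le)
    qed
  qed
qed

text \<open>The increments are dominated by a geometric series on each of the discs of radius \<open>r n\<close>,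
  which exhaust the unit disc.\<close>

lemma holomorphic_limit_exhaustion:
  fixes F :: "nat \<Rightarrow> complex \<Rightarrow> complex" and r :: "nat \<Rightarrow> real"
  assumes hol: "\<And>n. F n holomorphic_on ball 0 1"
    and r: "mono r" "\<And>n. r n < 1" "r \<longlonglongrightarrow> 1"
    and close: "\<And>n z. norm z \<le> r n \<Longrightarrow> norm (F (Suc n) z - F n z) \<le> (1/2) ^ n"
  obtains G where "G holomorphic_on ball 0 1"
    and "\<And>n z. norm z \<le> r n \<Longrightarrow> norm (G z - F n z) \<le> 2 * (1/2) ^ n"
proof -
  have tele: "norm (F (n + j) z - F n z) \<le> 2 * (1/2) ^ n - 2 * (1/2) ^ (n + j)" if "norm z \<le> r n" for n j z
  proof (induction j)
    case (Suc j)
    have "norm z \<le> r (n + j)" using that monoD[OF r(1), of n "n + j"] by simp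
    from close[OF this] Suc show ?case
      using norm_triangle_ineq[of "F (Suc (n + j)) z - F (n + j) z" "F (n + j) z - F n z"] by simp
  qed simp
  have bound: "norm (F m z - F n z) \<le> 2 * (1/2) ^ n" if "norm z \<le> r n" "n \<le> m" for n m z
  proof -
    have "norm (F m z - F n z) \<le> 2 * (1/2) ^ n - 2 * (1/2) ^ m"
      using tele[OF that(1), of "m - n"] that(2) by simp
    also have "\<dots> \<le> 2 * (1/2) ^ n" by simp
    finally show ?thesis .
  qed
  have small: "\<exists>n\<ge>n0. 2 * (1/2) ^ n < e" if "e > 0" for e :: real and n0 :: nat
  proof -
    have "(\<lambda>n. 2 * (1/2::real) ^ n) \<longlonglongrightarrow> 2 * 0" by (intro tendsto_intros LIMSEQ_power_zero) auto
    from order_tendstoD(2)[OF this] that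
    have "\<forall>\<^sub>F n in sequentially. 2 * (1/2) ^ n < e" by (metis mult_zero_right)
    then show ?thesis unfolding eventually_sequentially by (metis nle_le)
  qed
  have inside: "\<exists>n. \<rho> < r n" if "\<rho> < 1" for \<rho>
    using order_tendstoD(1)[OF r(3) that] by (metis eventually_sequentially order_refl)
  have conv: "convergent (\<lambda>m. F m z)" if z: "norm z < 1" for z
  proof (rule Cauchy_convergent, rule metric_CauchyI)
    fix e :: real assume "e > 0"
    obtain n0 where n0: "norm z < r n0" using inside[OF z] by blast
    obtain n where n: "n \<ge> n0" "2 * (1/2) ^ n < e / 2" using small[of "e/2" n0] \<open>e > 0\<close> by auto
    have zn: "norm z \<le> r n" using n0 monoD[OF r(1) n(1)] by simp
    have "dist (F m z) (F m' z) < e" if "m \<ge> n" "m' \<ge> n" for m m'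
      using bound[OF zn that(1)] bound[OF zn that(2)] n(2)
        dist_triangle3[of "F m z" "F m' z" "F n z"] by (simp add: dist_norm norm_minus_commute)
    then show "\<exists>M. \<forall>m\<ge>M. \<forall>n\<ge>M. dist (F m z) (F n z) < e" by blast
  qed
  define G where "G z = lim (\<lambda>m. F m z)" for z
  have G: "norm (G z - F n z) \<le> 2 * (1/2) ^ n" if "norm z \<le> r n" for n z
  proof -
    have "norm z < 1" using that r(2)[of n] by simp
    then have "(\<lambda>m. F m z) \<longlonglongrightarrow> G z" using conv unfolding G_def by (simp add: convergent_LIMSEQ_iff)
    then have "(\<lambda>m. norm (F m z - F n z)) \<longlonglongrightarrow> norm (G z - F n z)" by (intro tendsto_intros)
    then show ?thesis
      by (rule Lim_bounded[where M = n]) (use bound[OF that] in auto)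
  qed
  have "G holomorphic_on ball 0 1"
  proof (rule holomorphic_uniform_sequence[OF open_ball hol])
    fix x :: complex assume "x \<in> ball 0 1"
    then obtain n0 where n0: "norm x < r n0" using inside by auto
    define d where "d = r n0 - norm x"
    have "d > 0" using n0 by (simp add: d_def)
    have cb: "norm z \<le> r n0" if "z \<in> cball x d" for z
      using that norm_triangle_sub[of z x] by (auto simp: d_def dist_norm norm_minus_commute)
    have "uniform_limit (cball x d) F G sequentially"
    proof (rule uniform_limitI)
      fix e :: real assume "e > 0"
      obtain n where n: "n \<ge> n0" "2 * (1/2) ^ n < e" using small[OF \<open>e > 0\<close>] by blast
      have "dist (F m z) (G z) < e" if "m \<ge> n" "z \<in> cball x d" for m z
      proof -
        have "norm z \<le> r m" using cb[OF that(2)] monoD[OF r(1), of n0 m] n(1) that(1) by simp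
        then have "norm (G z - F m z) \<le> 2 * (1/2) ^ m" by (rule G)
        also have "\<dots> \<le> 2 * (1/2) ^ n" using that(1) by (intro mult_left_mono power_decreasing) auto
        finally show ?thesis using n(2) by (simp add: dist_norm norm_minus_commute)
      qed
      then show "\<forall>\<^sub>F m in sequentially. \<forall>z\<in>cball x d. dist (F m z) (G z) < e"
        unfolding eventually_sequentially by blast
    qed
    moreover have "cball x d \<subseteq> ball 0 1" using cb r(2)[of n0] by force
    ultimately show "\<exists>d>0. cball x d \<subseteq> ball 0 1 \<and> uniform_limit (cball x d) F G sequentially"
      using \<open>d > 0\<close> by blast
  qed
  with G that show ?thesis by blast
qed

section \<open>Real parts of holomorphic functions\<close>

lemma has_partials_on_Re:
  assumes "g holomorphic_on S" "open S"
  shows "has_partials_on (\<lambda>z. Re (g z)) (\<lambda>z. Re (deriv g z)) (\<lambda>z. - Im (deriv g z)) S"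
  unfolding has_partials_on_def
proof
  fix z assume "z \<in> S"
  then have "(g has_derivative (\<lambda>h. deriv g z * h)) (at z)"
    using holomorphic_derivI[OF assms] by (simp add: has_field_derivative_def)
  then have "((\<lambda>z. Re (g z)) has_derivative (\<lambda>h. Re (deriv g z * h))) (at z)"
    by (rule has_derivative_Re)
  then show "((\<lambda>z. Re (g z)) has_derivative
      (\<lambda>h. Re (deriv g z) * Re h + - Im (deriv g z) * Im h)) (at z)" by simp
qed

text \<open>This serves the second partial derivative of \<open>Re f\<close>: by the Cauchy--Riemann equations the
  \<open>y\<close>-derivative of \<open>Re f\<close> is \<open>- Im f'\<close>.\<close>

lemma has_partials_on_Im:
  assumes "g holomorphic_on S" "open S"
  shows "has_partials_on (\<lambda>z. - Im (g z)) (\<lambda>z. - Im (deriv g z)) (\<lambda>z. - Re (deriv g z)) S"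
  unfolding has_partials_on_def
proof
  fix z assume "z \<in> S"
  then have "(g has_derivative (\<lambda>h. deriv g z * h)) (at z)"
    using holomorphic_derivI[OF assms] by (simp add: has_field_derivative_def)
  then have "((\<lambda>z. - Im (g z)) has_derivative (\<lambda>h. - Im (deriv g z * h))) (at z)"
    by (intro has_derivative_minus has_derivative_Im)
  then show "((\<lambda>z. - Im (g z)) has_derivative
      (\<lambda>h. - Im (deriv g z) * Re h + - Re (deriv g z) * Im h)) (at z)" by (simp add: algebra_simps)
qed

lemma harmonic_on_Re:
  assumes g: "g holomorphic_on S" and S: "open S"
  shows "harmonic_on (\<lambda>z. Re (g z)) S"
proof -
  have g': "deriv g holomorphic_on S" and "deriv (deriv g) holomorphic_on S"
    using g S by (auto intro: holomorphic_deriv)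
  then have c: "continuous_on S (deriv (deriv g))" by (simp add: holomorphic_on_imp_continuous_on)
  show ?thesis
    unfolding harmonic_on_def
  proof (intro conjI exI)
    show "has_partials_on (\<lambda>z. Re (g z)) (\<lambda>z. Re (deriv g z)) (\<lambda>z. - Im (deriv g z)) S"
      by (rule has_partials_on_Re[OF g S])
    show "has_partials_on (\<lambda>z. Re (deriv g z)) (\<lambda>z. Re (deriv (deriv g) z)) (\<lambda>z. - Im (deriv (deriv g) z)) S"
      by (rule has_partials_on_Re[OF g' S])
    show "has_partials_on (\<lambda>z. - Im (deriv g z)) (\<lambda>z. - Im (deriv (deriv g) z)) (\<lambda>z. - Re (deriv (deriv g) z)) S"
      by (rule has_partials_on_Im[OF g' S])
  qed (use S c in \<open>auto intro!: continuous_intros\<close>)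
qed

section \<open>The harmonic pair\<close>

text \<open>Iterating \<open>raising_step\<close> with \<open>k = n\<close> and \<open>e = (1/2) ^ n\<close>. A point \<open>z\<close> with
  \<open>r m \<le> \<bar>z\<bar> < r (m + 1)\<close> has maximum greater than \<open>m\<close> at stage \<open>m\<close>, loses at most 1 in the next
  correction, and at most 1 in all later ones together, since those are small on the disc of radius
  \<open>r (m + 1)\<close>. This is where the 2 in the bound comes from.\<close>

lemma holomorphic_pair_with_large_max:
  obtains G1 G2 :: "complex \<Rightarrow> complex" and r :: "nat \<Rightarrow> real"
  where "G1 holomorphic_on ball 0 1" "G2 holomorphic_on ball 0 1" "\<And>n. r n < 1"
    and "\<And>n z. r n \<le> norm z \<Longrightarrow> norm z < 1 \<Longrightarrow> real n - 2 < max (Re (G1 z)) (Re (G2 z))"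
proof -
  define P :: "nat \<Rightarrow> (complex \<Rightarrow> complex) \<times> (complex \<Rightarrow> complex) \<times> real \<Rightarrow> bool" where
    "P n s \<longleftrightarrow> (case s of (f1, f2, r) \<Rightarrow> f1 analytic_on cball 0 1 \<and> f2 analytic_on cball 0 1 \<and>
       1 - 1 / (real n + 1) \<le> r \<and> r < 1 \<and>
       (\<forall>z. r \<le> norm z \<longrightarrow> norm z \<le> 1 \<longrightarrow> real n < max (Re (f1 z)) (Re (f2 z))))" for n s
  define Q :: "nat \<Rightarrow> (complex \<Rightarrow> complex) \<times> (complex \<Rightarrow> complex) \<times> real \<Rightarrow>
      (complex \<Rightarrow> complex) \<times> (complex \<Rightarrow> complex) \<times> real \<Rightarrow> bool" where
    "Q n s s' \<longleftrightarrow> (case s of (f1, f2, r) \<Rightarrow> case s' of (f1', f2', r') \<Rightarrow> r \<le> r' \<and>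
       (\<forall>z. norm z \<le> r \<longrightarrow> norm (f1' z - f1 z) \<le> (1/2) ^ n \<and> norm (f2' z - f2 z) \<le> (1/2) ^ n) \<and>
       (\<forall>z. norm z \<le> 1 \<longrightarrow> real n < max (Re (f1 z)) (Re (f2 z)) \<longrightarrow>
            real n - 1 < max (Re (f1' z)) (Re (f2' z))))" for n s s'
  have "\<exists>s. \<forall>n. P n (s n) \<and> Q n (s n) (s (Suc n))"
  proof (rule dependent_nat_choice)
    \<comment> \<open>Every value of the starting pair exceeds \<open>0\<close>, so the inner radius may be \<open>0\<close>.\<close>
    have "P 0 (\<lambda>_. 1, \<lambda>_. 1, 0)" by (simp add: P_def)
    then show "\<exists>s. P 0 s" by blast
  next
    fix s n assume s: "P n s"
    obtain f1 f2 r where seq: "s = (f1, f2, r)" by (cases s) auto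
    have f: "f1 analytic_on cball 0 1" "f2 analytic_on cball 0 1"
      and r: "1 - 1 / (real n + 1) \<le> r" "r < 1"
      and large: "\<And>z. r \<le> norm z \<Longrightarrow> norm z \<le> 1 \<Longrightarrow> real n < max (Re (f1 z)) (Re (f2 z))"
      using s by (auto simp: P_def seq)
    have "0 \<le> 1 - 1 / (real n + 1)" by simp
    then have r0: "0 \<le> r" using r(1) by linarith
    have sph: "real n < max (Re (f1 z)) (Re (f2 z))" if "norm z = 1" for z using large[of z] that r(2) by simp
    have pw: "(1/2::real) ^ n > 0" by simp
    obtain g1 g2 where g: "g1 analytic_on cball 0 1" "g2 analytic_on cball 0 1"
      "\<And>z. norm z \<le> r \<Longrightarrow> norm (g1 z) \<le> (1/2) ^ n" "\<And>z. norm z \<le> r \<Longrightarrow> norm (g2 z) \<le> (1/2) ^ n"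
      "\<And>z. norm z = 1 \<Longrightarrow> real (Suc n) < max (Re (f1 z + g1 z)) (Re (f2 z + g2 z))"
      "\<And>z. norm z \<le> 1 \<Longrightarrow> real n < max (Re (f1 z)) (Re (f2 z)) \<Longrightarrow>
           real n - (1/2) ^ n < max (Re (f1 z + g1 z)) (Re (f2 z + g2 z))"
      using raising_step[OF f sph r0 r(2) pw, where k' = "real (Suc n)"] by metis
    have fg: "(\<lambda>z. f1 z + g1 z) analytic_on cball 0 1" "(\<lambda>z. f2 z + g2 z) analytic_on cball 0 1"
      using f g(1,2) by (auto intro: analytic_on_add)
    have "max r (1 - 1 / (real (Suc n) + 1)) < 1" using r(2) by simp
    then obtain r' where r': "max r (1 - 1 / (real (Suc n) + 1)) \<le> r'" "r' < 1"
      "\<And>z. r' \<le> norm z \<Longrightarrow> norm z \<le> 1 \<Longrightarrow> real (Suc n) < max (Re (f1 z + g1 z)) (Re (f2 z + g2 z))"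
      using large_on_annulus[OF fg g(5)] by metis
    have "(1/2::real) ^ n \<le> 1" by (simp add: power_le_one)
    then have keep: "real n - 1 < max (Re (f1 z + g1 z)) (Re (f2 z + g2 z))"
      if "norm z \<le> 1" "real n < max (Re (f1 z)) (Re (f2 z))" for z
      using g(6)[OF that] by linarith
    have "P (Suc n) (\<lambda>z. f1 z + g1 z, \<lambda>z. f2 z + g2 z, r')"
      unfolding P_def prod.case using fg r' by (intro conjI allI impI) auto
    moreover have "Q n s (\<lambda>z. f1 z + g1 z, \<lambda>z. f2 z + g2 z, r')"
      unfolding Q_def seq prod.case using g(3,4) r'(1) keep by (intro conjI allI impI) auto
    ultimately show "\<exists>s'. P (Suc n) s' \<and> Q n s s'" by blast
  qed
  then obtain s where s: "\<And>n. P n (s n)" "\<And>n. Q n (s n) (s (Suc n))" by blast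
  define F1 where "F1 n = fst (s n)" for n
  define F2 where "F2 n = fst (snd (s n))" for n
  define r where "r n = snd (snd (s n))" for n
  have seq: "s n = (F1 n, F2 n, r n)" for n by (simp add: F1_def F2_def r_def)
  have an: "F1 n analytic_on cball 0 1" "F2 n analytic_on cball 0 1"
    and r: "1 - 1 / (real n + 1) \<le> r n" "r n < 1"
    and large: "\<And>z. r n \<le> norm z \<Longrightarrow> norm z \<le> 1 \<Longrightarrow> real n < max (Re (F1 n z)) (Re (F2 n z))" for n
    using s(1)[of n] unfolding P_def seq prod.case by blast+
  have step: "r n \<le> r (Suc n)"
    and close1: "\<And>z. norm z \<le> r n \<Longrightarrow> norm (F1 (Suc n) z - F1 n z) \<le> (1/2) ^ n"
    and close2: "\<And>z. norm z \<le> r n \<Longrightarrow> norm (F2 (Suc n) z - F2 n z) \<le> (1/2) ^ n"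
    and keep: "\<And>z. norm z \<le> 1 \<Longrightarrow> real n < max (Re (F1 n z)) (Re (F2 n z)) \<Longrightarrow>
            real n - 1 < max (Re (F1 (Suc n) z)) (Re (F2 (Suc n) z))" for n
    using s(2)[of n] unfolding Q_def seq prod.case by blast+
  have mono: "mono r" using step by (simp add: mono_iff_le_Suc)
  have lim: "r \<longlonglongrightarrow> 1"
  proof (rule real_tendsto_sandwich)
    show "(\<lambda>n. 1 - 1 / (real n + 1)) \<longlonglongrightarrow> 1"
      using tendsto_diff[OF tendsto_const[of 1] LIMSEQ_inverse_real_of_nat] by (simp add: inverse_eq_divide add.commute)
    show "(\<lambda>n. 1::real) \<longlonglongrightarrow> 1" by simp
  qed (use r in \<open>auto intro!: always_eventually intro: less_imp_le\<close>)
  have hol: "F1 n holomorphic_on ball 0 1" "F2 n holomorphic_on ball 0 1" for n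
    using an[of n] by (auto intro!: analytic_imp_holomorphic elim!: analytic_on_subset)
  obtain G1 where G1: "G1 holomorphic_on ball 0 1"
    "\<And>n z. norm z \<le> r n \<Longrightarrow> norm (G1 z - F1 n z) \<le> 2 * (1/2) ^ n"
    using holomorphic_limit_exhaustion[OF hol(1) mono r(2) lim close1] by metis
  obtain G2 where G2: "G2 holomorphic_on ball 0 1"
    "\<And>n z. norm z \<le> r n \<Longrightarrow> norm (G2 z - F2 n z) \<le> 2 * (1/2) ^ n"
    using holomorphic_limit_exhaustion[OF hol(2) mono r(2) lim close2] by metis
  show ?thesis
  proof
    show "G1 holomorphic_on ball 0 1" "G2 holomorphic_on ball 0 1" "\<And>n. r n < 1" by fact+
    fix n and z :: complex assume z: "r n \<le> norm z" "norm z < 1"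
    have "\<exists>m. norm z < r m" using order_tendstoD(1)[OF lim z(2)] by (metis eventually_sequentially order_refl)
    \<comment> \<open>The first disc containing \<open>z\<close>; stage \<open>p - 1\<close> made the maximum large at \<open>z\<close>.\<close>
    define p where "p = (LEAST m. norm z < r m)"
    have p: "norm z < r p" unfolding p_def by (rule LeastI_ex) fact
    have "p \<noteq> 0 \<and> n < p"
      using p z(1) monoD[OF mono, of p n] by (metis leI less_le_trans not_less not_less0 order_less_irrefl)
    then obtain m where m: "p = Suc m" "n \<le> m" by (cases p) auto
    have "\<not> norm z < r m" using not_less_Least[of m "\<lambda>m. norm z < r m"] m(1) by (simp add: p_def)
    then have "real m - 1 < max (Re (F1 p z)) (Re (F2 p z))"
      using keep[of z m] large[of m z] z(2) by (simp add: m(1))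
    moreover have "2 * (1/2::real) ^ p \<le> 1" by (simp add: m(1) power_le_one)
    then have "norm (G1 z - F1 p z) \<le> 1" "norm (G2 z - F2 p z) \<le> 1"
      using G1(2)[of z p] G2(2)[of z p] p by linarith+
    then have "\<bar>Re (G1 z) - Re (F1 p z)\<bar> \<le> 1" "\<bar>Re (G2 z) - Re (F2 p z)\<bar> \<le> 1"
      using abs_Re_le_cmod[of "G1 z - F1 p z"] abs_Re_le_cmod[of "G2 z - F2 p z"] by auto
    ultimately show "real n - 2 < max (Re (G1 z)) (Re (G2 z))"
      using m(2) by linarith
  qed
qed

theorem theorem1p4:
  shows "\<exists>u1 u2 :: complex \<Rightarrow> real.
    harmonic_on u1 (ball 0 1) \<and> harmonic_on u2 (ball 0 1) \<and>
    filterlim (\<lambda>z. max (u1 z) (u2 z)) at_top (filtercomap norm (at_left 1))"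
proof -
  obtain G1 G2 :: "complex \<Rightarrow> complex" and r :: "nat \<Rightarrow> real"
    where G: "G1 holomorphic_on ball 0 1" "G2 holomorphic_on ball 0 1" and r: "\<And>n. r n < 1"
      and large: "\<And>n z. r n \<le> norm z \<Longrightarrow> norm z < 1 \<Longrightarrow> real n - 2 < max (Re (G1 z)) (Re (G2 z))"
    using holomorphic_pair_with_large_max by metis
  have "filterlim (\<lambda>z. max (Re (G1 z)) (Re (G2 z))) at_top (filtercomap norm (at_left 1))"
    unfolding filterlim_at_top
  proof
    fix Z :: real
    obtain n :: nat where n: "Z + 2 < real n" using reals_Archimedean2 by blast
    have "\<forall>\<^sub>F t in at_left 1. r n < t \<and> t < 1"
      using eventually_at_left_real[OF r[of n]] by simp
    then show "\<forall>\<^sub>F z in filtercomap norm (at_left 1). Z \<le> max (Re (G1 z)) (Re (G2 z))"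
      unfolding eventually_filtercomap
    proof (intro exI[of _ "\<lambda>t. r n < t \<and> t < 1"] conjI allI impI)
      fix z :: complex assume "r n < norm z \<and> norm z < 1"
      then show "Z \<le> max (Re (G1 z)) (Re (G2 z))" using large[of n z] n by linarith
    qed
  qed
  then show ?thesis using harmonic_on_Re[OF G(1) open_ball] harmonic_on_Re[OF G(2) open_ball] by blast
qed

end
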